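(* Let $r,s,t$ be three distinct integers with $r\neq 0$, and put $x=(s-r)/r$ and $y=(t-r)/r$, so that $x,y\in\mathbb{Q}\setminus\{0\}$ and $x\neq y$. The multiset $\{r^{[7]},s,t\}$ is $\mathrm{PSI}$ in dimension three if and only if the following eight polynomials in $z$ all split completely over $\mathbb{Q}$: $$\begin{aligned} p_{1x}&=z\,[z^2-(3+x)z+2x-y],\\ p_{1y}&=z\,[z^2-(3+y)z+2y-x],\\ p_2&=z\,[z^2-3z-x-y],\\ p_3&=z^3-(3+x+y)z^2+(xy+2x+2y)z-xy,\\ p_{4x}&=z^3-(3+x)z^2+(2x-y)z+xy,\\ p_{4y}&=z^3-(3+y)z^2+(2y-x)z+xy,\\ p_5&=z^3-3z^2-(xy+x+y)z+xy,\\ p_6&=z^3-3z^2-(x+y)z-xy. \end{aligned}$$ Moreover, the $72$ ordered placements of the two deviations form $12$ orbits under permutation similarity, and the characteristic polynomials $\det(zI_3-\overline{M})$ of the corresponding normalized matrices $\overline{M}$ are exactly these eight polynomial types.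
   Context: For a multiset $\mathcal{S}$ of $n^2$ integers, $\mathcal{M}_n(\mathcal{S})$ denotes the set of all $n\times n$ integer matrices whose $n^2$ entries, counted with multiplicity, are exactly the elements of $\mathcal{S}$. A matrix has integral spectrum if all its eigenvalues are integers. $\mathcal{S}$ is permutation-spectrally integral in dimension $n$ ($\mathrm{PSI}$ in dimension $n$) if every matrix in $\mathcal{M}_n(\mathcal{S})$ has integral spectrum. The notation $r^{[m]}$ means $m$ copies of $r$. $J_3$ is the $3\times 3$ all-ones matrix and $E_{ij}$ the $3\times3$ matrix unit with a $1$ in position $(i,j)$ and zeros elsewhere. An ordered placement of the two deviations is an ordered pair $((i_1,j_1),(i_2,j_2))$ of distinct positions in $\{1,2,3\}^2$; it corresponds to the matrix $M\in\mathcal{M}_3(\{r^{[7]},s,t\})$ with entry $s$ at $(i_1,j_1)$, entry $t$ at $(i_2,j_2)$ and $r$ elsewhere, and to the normalized matrix $\overline{M}=M/r=J_3+xE_{i_1j_1}+yE_{i_2j_2}$, whose eigenvalues are $z=\lambda/r$ with $\lambda$ an eigenvalue of $M$. Permutation similarity acts on placements by $\sigma\cdot((i_1,j_1),(i_2,j_2))=((\sigma(i_1),\sigma(j_1)),(\sigma(i_2),\sigma(j_2)))$ for permutations $\sigma$ of $\{1,2,3\}$. *)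

theory Defs
  imports
    "Jordan_Normal_Form.Spectral_Radius"
    "HOL-Library.Multiset"
    "HOL-Combinatorics.Permutations"
begin

section \<open>Permutation-spectrally integral multisets\<close>

definition entries_mset :: "'a mat \<Rightarrow> 'a multiset" where
  "entries_mset A = image_mset (\<lambda>p. A $$ p) (mset_set ({..<dim_row A} \<times> {..<dim_col A}))"

definition matrices_of :: "nat \<Rightarrow> int multiset \<Rightarrow> int mat set" where
  "matrices_of n S = {A \<in> carrier_mat n n. entries_mset A = S}"

definition integral_spectrum :: "int mat \<Rightarrow> bool" where
  "integral_spectrum A \<longleftrightarrow> spectrum (map_mat complex_of_int A) \<subseteq> \<int>"

text \<open>Only meaningful for \<open>size S = n\<^sup>2\<close>; otherwise \<open>matrices_of n S\<close> is empty.\<close>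

definition PSI :: "nat \<Rightarrow> int multiset \<Rightarrow> bool" where
  "PSI n S \<longleftrightarrow> (\<forall>A \<in> matrices_of n S. integral_spectrum A)"

definition splits_completely :: "'a::field poly \<Rightarrow> bool" where
  "splits_completely p \<longleftrightarrow> (\<exists>c as. p = Polynomial.smult c (\<Prod>a\<leftarrow>as. [:- a, 1:]))"


section \<open>Placements of the two deviations\<close>

text \<open>Rows and columns are numbered 0, 1, 2, the convention for matrices in the library.\<close>

type_synonym position = "nat \<times> nat"
type_synonym placement = "position \<times> position"

definition placements :: "placement set" where
  "placements = {(u, v). u \<in> {..<3} \<times> {..<3} \<and> v \<in> {..<3} \<times> {..<3} \<and> u \<noteq> v}"

definition placement_mat :: "int \<Rightarrow> int \<Rightarrow> int \<Rightarrow> placement \<Rightarrow> int mat" where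
  "placement_mat r s t p =
     mat 3 3 (\<lambda>ij. if ij = fst p then s else if ij = snd p then t else r)"

definition normalized_mat :: "int \<Rightarrow> int \<Rightarrow> int \<Rightarrow> placement \<Rightarrow> rat mat" where
  "normalized_mat r s t p = (1 / of_int r) \<cdot>\<^sub>m map_mat rat_of_int (placement_mat r s t p)"

definition all_ones_mat :: "rat mat" where
  "all_ones_mat = mat 3 3 (\<lambda>_. 1)"

definition unit_mat :: "position \<Rightarrow> rat mat" where
  "unit_mat u = mat 3 3 (\<lambda>ij. if ij = u then 1 else 0)"

definition deviation_mat :: "rat \<Rightarrow> rat \<Rightarrow> placement \<Rightarrow> rat mat" where
  "deviation_mat x y p = all_ones_mat + x \<cdot>\<^sub>m unit_mat (fst p) + y \<cdot>\<^sub>m unit_mat (snd p)"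

lemma normalized_mat_eq_deviation_mat:
  assumes "r \<noteq> 0" and "p \<in> placements"
  shows "normalized_mat r s t p =
    deviation_mat (of_int (s - r) / of_int r) (of_int (t - r) / of_int r) p"
  by (rule eq_matI)
    (use assms in \<open>auto simp: normalized_mat_def placement_mat_def deviation_mat_def
      all_ones_mat_def unit_mat_def placements_def field_simps\<close>)

definition perm_act :: "(nat \<Rightarrow> nat) \<Rightarrow> placement \<Rightarrow> placement" where
  "perm_act \<sigma> = map_prod (map_prod \<sigma> \<sigma>) (map_prod \<sigma> \<sigma>)"

definition placement_orbit :: "placement \<Rightarrow> placement set" where
  "placement_orbit p = {perm_act \<sigma> p | \<sigma>. \<sigma> permutes {..<3}}"

definition placement_orbits :: "placement set set" where
  "placement_orbits = placement_orbit ` placements"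


section \<open>The eight polynomials\<close>

text \<open>As polynomials in \<open>z\<close>; coefficient lists start with the constant term.\<close>

definition p1x :: "rat \<Rightarrow> rat \<Rightarrow> rat poly" where
  "p1x x y = [:0, 1:] * [:2*x - y, - (3 + x), 1:]"

definition p1y :: "rat \<Rightarrow> rat \<Rightarrow> rat poly" where
  "p1y x y = [:0, 1:] * [:2*y - x, - (3 + y), 1:]"

definition p2 :: "rat \<Rightarrow> rat \<Rightarrow> rat poly" where
  "p2 x y = [:0, 1:] * [:- x - y, - 3, 1:]"

definition p3 :: "rat \<Rightarrow> rat \<Rightarrow> rat poly" where
  "p3 x y = [:- (x*y), x*y + 2*x + 2*y, - (3 + x + y), 1:]"

definition p4x :: "rat \<Rightarrow> rat \<Rightarrow> rat poly" where
  "p4x x y = [:x*y, 2*x - y, - (3 + x), 1:]"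

definition p4y :: "rat \<Rightarrow> rat \<Rightarrow> rat poly" where
  "p4y x y = [:x*y, 2*y - x, - (3 + y), 1:]"

definition p5 :: "rat \<Rightarrow> rat \<Rightarrow> rat poly" where
  "p5 x y = [:x*y, - (x*y + x + y), - 3, 1:]"

definition p6 :: "rat \<Rightarrow> rat \<Rightarrow> rat poly" where
  "p6 x y = [:- (x*y), - (x + y), - 3, 1:]"

text \<open>A polynomial type is a polynomial in \<open>z\<close> depending on the parameters \<open>x\<close> and \<open>y\<close>.\<close>

definition poly_types :: "(rat \<Rightarrow> rat \<Rightarrow> rat poly) set" where
  "poly_types = {p1x, p1y, p2, p3, p4x, p4y, p5, p6}"

end

theory Submission
  imports Defs
begin

text \<open>
  The condition on the multiset concerns only 72 matrices: since \<open>r\<close>, \<open>s\<close>, \<open>t\<close> are distinct, a matrix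
  with the prescribed entries is determined by the positions of \<open>s\<close> and of \<open>t\<close>
  (\<open>matrices_of_two_deviations\<close>).

  For a single integer matrix \<open>A\<close>, having an integral spectrum is the same as the characteristic
  polynomial of \<open>A / r\<close> splitting over the rationals
  (\<open>integral_spectrum_iff_splits_completely\<close>). If all eigenvalues are integers, then the
  complex factorisation of the characteristic polynomial of \<open>A / r\<close> has only rational roots and
  therefore already holds over the rationals. Conversely, if that polynomial splits, then every
  eigenvalue of \<open>A\<close> is rational, and it is also an algebraic integer, being a root of the monic
  integer polynomial \<open>char_poly A\<close>; rational algebraic integers are integers.

  It remains to see which characteristic polynomials occur. The coefficients are the trace, the
  sum of the principal minors and the determinant, so the polynomial depends only on how the two
  deviating positions meet the diagonal and each other. The function \<open>placement_type\<close> records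
  this case distinction, and \<open>char_poly_deviation_mat\<close> verifies it; its range is the set of the
  eight types, and these are pairwise different because they already differ at \<open>x = 1\<close>, \<open>y = 2\<close>.

  The number of orbits is \<open>72 / 6\<close> because the symmetric group on three points acts freely
  (\<open>perm_act_free\<close>): two distinct positions involve at least two of the three indices, and a
  permutation of three points that fixes two of them is the identity.
\<close>


section \<open>Characteristic polynomials of 3 by 3 matrices\<close>

lemma det_2:
  fixes A :: "'a::comm_ring_1 mat"
  assumes A: "A \<in> carrier_mat 2 2"
  shows "det A = A $$ (0,0) * A $$ (1,1) - A $$ (0,1) * A $$ (1,0)"
proof -
  have D: "det (mat_delete A 0 j) = mat_delete A 0 j $$ (0,0)" for j
    using mat_delete_carrier[OF A, of 0 j] by (intro det_single) simp
  have "cofactor A 0 0 = A $$ (1,1)" "cofactor A 0 1 = - A $$ (1,0)"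
    using A unfolding cofactor_def D by (simp_all add: mat_delete_def)
  with laplace_expansion_row[OF A, of 0] show ?thesis
    by (simp add: numeral_2_eq_2)
qed

lemma det_3:
  fixes A :: "'a::comm_ring_1 mat"
  assumes A: "A \<in> carrier_mat 3 3"
  shows "det A =
      A $$ (0,0) * (A $$ (1,1) * A $$ (2,2) - A $$ (1,2) * A $$ (2,1))
    - A $$ (0,1) * (A $$ (1,0) * A $$ (2,2) - A $$ (1,2) * A $$ (2,0))
    + A $$ (0,2) * (A $$ (1,0) * A $$ (2,1) - A $$ (1,1) * A $$ (2,0))"
proof -
  have D: "det (mat_delete A 0 j) =
      mat_delete A 0 j $$ (0,0) * mat_delete A 0 j $$ (1,1)
      - mat_delete A 0 j $$ (0,1) * mat_delete A 0 j $$ (1,0)" for j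
    using mat_delete_carrier[OF A, of 0 j] by (intro det_2) simp
  have "cofactor A 0 0 = A $$ (1,1) * A $$ (2,2) - A $$ (1,2) * A $$ (2,1)"
    "cofactor A 0 1 = - (A $$ (1,0) * A $$ (2,2) - A $$ (1,2) * A $$ (2,0))"
    "cofactor A 0 2 = A $$ (1,0) * A $$ (2,1) - A $$ (1,1) * A $$ (2,0)"
    using A unfolding cofactor_def D by (simp_all add: mat_delete_def numeral_2_eq_2)
  moreover have "det A = A $$ (0,0) * cofactor A 0 0 + A $$ (0,1) * cofactor A 0 1
      + A $$ (0,2) * cofactor A 0 2"
    using laplace_expansion_row[OF A, of 0] by (simp add: numeral_3_eq_3 numeral_2_eq_2)
  ultimately show ?thesis
    by (simp only: minus_mult_right[symmetric] diff_conv_add_uminus)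
qed

lemma char_poly_3:
  fixes A :: "'a::comm_ring_1 mat"
  assumes A: "A \<in> carrier_mat 3 3"
  shows "char_poly A =
    [: - det A,
       (A $$ (0,0) * A $$ (1,1) - A $$ (0,1) * A $$ (1,0))
       + (A $$ (0,0) * A $$ (2,2) - A $$ (0,2) * A $$ (2,0))
       + (A $$ (1,1) * A $$ (2,2) - A $$ (1,2) * A $$ (2,1)),
       - (A $$ (0,0) + A $$ (1,1) + A $$ (2,2)), 1 :]"
proof -
  have "char_poly_matrix A $$ (i, j) = [: - A $$ (i, j), if i = j then 1 else 0 :]"
    if "i < 3" "j < 3" for i j
    using that A by (simp add: char_poly_matrix_def)
  then show ?thesis
    unfolding char_poly_def det_3[OF A] det_3[OF char_poly_matrix_closed[OF A]]
    by (simp add: algebra_simps)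
qed


section \<open>The characteristic polynomials of the placements\<close>

text \<open>
  The branches are, in order: both deviations on the diagonal; only the first one there, and then
  whether the second one shares its row or column (if it does, two rows or two columns of the
  matrix agree and \<open>0\<close> is an eigenvalue); the same with the roles exchanged; both off the
  diagonal in a common row or column; at transposed positions; or chained as \<open>(a, b)\<close>, \<open>(b, c)\<close>
  in either order. The last condition is what remains, since two ordered pairs of distinct indices
  out of three always share an index.
\<close>

definition placement_type :: "placement \<Rightarrow> rat \<Rightarrow> rat \<Rightarrow> rat poly" where
  "placement_type = (\<lambda>((i, j), (k, l)).
     if i = j \<and> k = l then p3
     else if i = j then if i = k \<or> i = l then p1x else p4x
     else if k = l then if k = i \<or> k = j then p1y else p4y
     else if i = k \<or> j = l then p2
     else if i = l \<and> j = k then p5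
     else p6)"

lemmas poly_type_defs =
  p1x_def p1y_def p2_def p3_def p4x_def p4y_def p5_def p6_def

lemma deviation_mat_index:
  assumes "a < 3" "b < 3"
  shows "deviation_mat x y (u, v) $$ (a, b) =
    1 + (if (a, b) = u then x else 0) + (if (a, b) = v then y else 0)"
  using assms by (simp add: deviation_mat_def all_ones_mat_def unit_mat_def)

lemma char_poly_deviation_mat:
  assumes "p \<in> placements"
  shows "char_poly (deviation_mat x y p) = placement_type p x y"
proof -
  obtain i j k l where p: "p = ((i, j), (k, l))"
    by (metis surj_pair)
  have A: "deviation_mat x y ((i, j), (k, l)) \<in> carrier_mat 3 3"
    by (simp add: deviation_mat_def all_ones_mat_def unit_mat_def)
  have "i \<in> {0, 1, 2}" "j \<in> {0, 1, 2}" "k \<in> {0, 1, 2}" "l \<in> {0, 1, 2}" and ne: "(i, j) \<noteq> (k, l)"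
    using assms by (auto simp: p placements_def)
  then show ?thesis
    using ne unfolding p char_poly_3[OF A] det_3[OF A]
    \<comment> \<open>All choices of the four indices; in each the nine entries become explicit in \<open>x\<close> and \<open>y\<close>.\<close>
    by (elim insertE emptyE; hypsubst)
      (simp_all add: deviation_mat_index placement_type_def poly_type_defs algebra_simps)
qed

lemma placement_type_image: "placement_type ` placements = poly_types"
proof
  show "placement_type ` placements \<subseteq> poly_types"
    by (auto simp: placement_type_def poly_types_def)
  let ?witnesses = "{((0, 0), (0, 1)), ((0, 1), (0, 0)), ((0, 1), (0, 2)), ((0, 0), (1, 1)),
    ((0, 0), (1, 2)), ((1, 2), (0, 0)), ((0, 1), (1, 0)), ((0, 1), (1, 2))} :: placement set"
  have "poly_types = placement_type ` ?witnesses"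
    by (simp add: poly_types_def placement_type_def)
  also have "\<dots> \<subseteq> placement_type ` placements"
    by (rule image_mono) (simp add: placements_def)
  finally show "poly_types \<subseteq> placement_type ` placements" .
qed

lemma card_poly_types: "card poly_types = 8"
proof -
  \<comment> \<open>Types that exchange the roles of \<open>x\<close> and \<open>y\<close> agree whenever \<open>x = y\<close>, so the sample point that
    separates the types has different coordinates.\<close>
  have "card ((\<lambda>q. q 1 2) ` poly_types) = 8"
    by (simp add: poly_types_def poly_type_defs)
  moreover have "card ((\<lambda>q. q 1 2) ` poly_types) \<le> card poly_types"
    by (rule card_image_le) (simp add: poly_types_def)
  moreover have "card poly_types \<le> 8"
    unfolding poly_types_def by (rule card_insert_le_m1, simp)+ simp
  ultimately show ?thesis
    by linarith
qed


section \<open>Placements and their orbits\<close>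

lemma card_placements: "card placements = 72"
proof -
  let ?grid = "{..<3} \<times> {..<3} :: position set"
  have "placements = Sigma ?grid (\<lambda>u. ?grid - {u})"
    by (auto simp: placements_def)
  also have "card \<dots> = (\<Sum>u\<in>?grid. card (?grid - {u}))"
    by (rule card_SigmaI) simp_all
  also have "\<dots> = (\<Sum>u\<in>?grid. 8)"
    by (rule sum.cong) (simp_all add: card_Diff_singleton)
  finally show ?thesis
    by simp
qed

lemma perm_act_comp: "perm_act (\<sigma> \<circ> \<tau>) p = perm_act \<sigma> (perm_act \<tau> p)"
proof -
  obtain i j k l where "p = ((i, j), (k, l))"
    by (metis surj_pair)
  then show ?thesis
    by (simp add: perm_act_def)
qed

lemma perm_act_placements:
  assumes "\<sigma> permutes {..<3}" and "p \<in> placements"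
  shows "perm_act \<sigma> p \<in> placements"
proof -
  obtain i j k l where "p = ((i, j), (k, l))"
    by (metis surj_pair)
  moreover have "\<sigma> a < 3 \<longleftrightarrow> a < 3" for a
    using permutes_in_image[OF assms(1), of a] by simp
  ultimately show ?thesis
    using assms(2)
    by (simp add: perm_act_def placements_def inj_eq[OF permutes_inj[OF assms(1)]])
qed

lemma bij_eq_if_eq_off_point:
  assumes "bij \<sigma>" and "bij \<tau>" and off: "\<And>a. a \<noteq> c \<Longrightarrow> \<sigma> a = \<tau> a"
  shows "\<sigma> = \<tau>"
proof -
  obtain d where d: "\<tau> d = \<sigma> c"
    using \<open>bij \<tau>\<close> by (metis bij_pointE)
  have "d = c"
    using d off[of d] \<open>bij \<sigma>\<close> by (metis bij_is_inj injD)
  with d off show ?thesis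
    by (metis ext)
qed

text \<open>
  The stabiliser of a placement is trivial: its two positions cannot both be \<open>(a, a)\<close>, so at
  least two indices occur in them, and the image of the third index is then forced.
\<close>

lemma perm_act_free:
  assumes \<sigma>: "\<sigma> permutes {..<3}" and \<tau>: "\<tau> permutes {..<3}"
    and p: "p \<in> placements" and eq: "perm_act \<sigma> p = perm_act \<tau> p"
  shows "\<sigma> = \<tau>"
proof -
  obtain i j k l where ijkl: "p = ((i, j), (k, l))"
    by (metis surj_pair)
  have agree: "\<sigma> a = \<tau> a" if "a \<in> {i, j, k, l}" for a
    using eq that by (auto simp: ijkl perm_act_def)
  have lt: "{i, j, k, l} \<subseteq> {..<3}" and "(i, j) \<noteq> (k, l)"
    using p by (auto simp: ijkl placements_def)
  then obtain a b where ab: "a \<in> {i, j, k, l}" "b \<in> {i, j, k, l}" "a \<noteq> b"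
    by blast
  have "card ({..<3} - {a, b}) = 1"
    using ab lt by (subst card_Diff_subset) auto
  then obtain c where c: "{..<3} - {a, b} = {c}"
    by (auto simp: card_1_singleton_iff)
  have "\<sigma> d = \<tau> d" if "d \<noteq> c" for d
  proof (cases "d < 3")
    case True
    with that c have "d = a \<or> d = b" by auto
    then show ?thesis using ab agree by auto
  next
    case False
    then show ?thesis using \<sigma> \<tau> by (simp add: permutes_def)
  qed
  then show ?thesis
    using \<sigma> \<tau> by (intro bij_eq_if_eq_off_point[of \<sigma> \<tau> c]) (auto intro: permutes_bij)
qed

text \<open>By freeness an orbit is a bijective copy of the symmetric group on three points.\<close>

lemma card_placement_orbit:
  assumes "p \<in> placements"
  shows "card (placement_orbit p) = 6"
proof -
  have "placement_orbit p = (\<lambda>\<sigma>. perm_act \<sigma> p) ` {\<sigma>. \<sigma> permutes {..<3}}"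
    by (auto simp: placement_orbit_def)
  moreover have "inj_on (\<lambda>\<sigma>. perm_act \<sigma> p) {\<sigma>. \<sigma> permutes {..<3}}"
    using assms by (auto intro!: inj_onI intro: perm_act_free)
  ultimately have "card (placement_orbit p) = card {\<sigma>. \<sigma> permutes {..<3::nat}}"
    by (simp add: card_image)
  also have "\<dots> = fact 3"
    by (rule card_permutations) simp_all
  finally show ?thesis
    by (simp add: numeral_3_eq_3)
qed

lemma placement_orbit_perm_act_subset:
  assumes "\<sigma> permutes {..<3}"
  shows "placement_orbit (perm_act \<sigma> p) \<subseteq> placement_orbit p"
  unfolding placement_orbit_def perm_act_comp[symmetric]
  using permutes_compose[OF assms] by blast

lemma placement_orbit_eq:
  assumes "q \<in> placement_orbit p"
  shows "placement_orbit q = placement_orbit p"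
proof -
  from assms obtain \<sigma> where \<sigma>: "\<sigma> permutes {..<3}" and q: "q = perm_act \<sigma> p"
    by (auto simp: placement_orbit_def)
  have "p = perm_act (inv_into UNIV \<sigma>) q"
    unfolding q perm_act_comp[symmetric] permutes_inv_o(2)[OF \<sigma>]
    by (simp add: perm_act_def map_prod.id)
  then have "placement_orbit p \<subseteq> placement_orbit q"
    using placement_orbit_perm_act_subset[OF permutes_inv[OF \<sigma>]] by metis
  with placement_orbit_perm_act_subset[OF \<sigma>] show ?thesis
    unfolding q by (rule subset_antisym)
qed

lemma card_placement_orbits: "card placement_orbits = 12"
proof -
  have self: "p \<in> placement_orbit p" for p
    unfolding placement_orbit_def
    by (auto intro!: exI[of _ id] permutes_id simp: perm_act_def map_prod.id)
  have union: "\<Union> placement_orbits = placements"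
    using self perm_act_placements by (fastforce simp: placement_orbits_def placement_orbit_def)
  have fin: "finite placements"
    using card_placements by (metis card.infinite zero_neq_numeral)
  have "6 * card placement_orbits = card (\<Union> placement_orbits)"
  proof (rule card_partition)
    show "finite placement_orbits"
      using fin by (simp add: placement_orbits_def)
    show "finite (\<Union> placement_orbits)"
      using fin by (simp only: union)
    show "card P = 6" if "P \<in> placement_orbits" for P
      using that by (auto simp: placement_orbits_def card_placement_orbit)
    show "P \<inter> Q = {}" if P: "P \<in> placement_orbits" and Q: "Q \<in> placement_orbits" and "P \<noteq> Q" for P Q
    proof (rule ccontr)
      assume "P \<inter> Q \<noteq> {}"
      then obtain w where w: "w \<in> P" "w \<in> Q"
        by blast
      obtain p where "P = placement_orbit p"
        using P unfolding placement_orbits_def by (rule imageE)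
      moreover obtain q where "Q = placement_orbit q"
        using Q unfolding placement_orbits_def by (rule imageE)
      ultimately have "P = Q"
        using w placement_orbit_eq[of w] by metis
      with \<open>P \<noteq> Q\<close> show False
        by simp
    qed
  qed
  then show ?thesis
    by (simp add: union card_placements)
qed


section \<open>Matrices with seven equal entries and two deviations\<close>

lemma placement_mat_in_matrices_of:
  assumes "p \<in> placements"
  shows "placement_mat r s t p \<in> matrices_of 3 (replicate_mset 7 r + {#s, t#})"
proof -
  let ?grid = "{..<3} \<times> {..<3} :: position set"
  obtain u v where p: "p = (u, v)"
    by (cases p)
  then have uv: "u \<in> ?grid" "v \<in> ?grid" "u \<noteq> v"
    using assms by (auto simp: placements_def)
  let ?rest = "?grid - {u, v}"
  have grid: "?grid = insert u (insert v ?rest)"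
    using uv by blast
  have entry: "placement_mat r s t p $$ w = (if w = u then s else if w = v then t else r)"
    if "w \<in> ?grid" for w
    using that by (cases w) (simp add: p placement_mat_def)
  have "mset_set ?grid = mset_set ?rest + {#u, v#}"
    by (subst grid) (simp add: uv)
  moreover have "{#placement_mat r s t p $$ w. w \<in># mset_set ?rest#} = {#r. w \<in># mset_set ?rest#}"
    by (rule image_mset_cong) (simp add: entry)
  moreover have "size (mset_set ?rest) = 7"
    using uv by (simp add: card_Diff_subset)
  moreover have "placement_mat r s t p $$ u = s" "placement_mat r s t p $$ v = t"
    using uv by (simp_all add: entry)
  ultimately have "image_mset (($$) (placement_mat r s t p)) (mset_set ?grid)
      = replicate_mset 7 r + {#s, t#}"
    by (simp add: image_mset_const_eq)
  then show ?thesis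
    by (simp add: matrices_of_def entries_mset_def placement_mat_def)
qed

text \<open>
  Distinctness of the three values makes the multiplicities of \<open>s\<close> and \<open>t\<close> among the entries equal
  to one, so each of them marks a unique position.
\<close>

lemma matrices_of_two_deviations:
  assumes "r \<noteq> s" "r \<noteq> t" "s \<noteq> t"
  shows "matrices_of 3 (replicate_mset 7 r + {#s, t#}) = placement_mat r s t ` placements"
proof
  show "placement_mat r s t ` placements \<subseteq> matrices_of 3 (replicate_mset 7 r + {#s, t#})"
    using placement_mat_in_matrices_of by blast
  show "matrices_of 3 (replicate_mset 7 r + {#s, t#}) \<subseteq> placement_mat r s t ` placements"
  proof
    let ?grid = "{..<3} \<times> {..<3} :: position set"
    fix A assume "A \<in> matrices_of 3 (replicate_mset 7 r + {#s, t#})"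
    then have A: "A \<in> carrier_mat 3 3"
      and entries: "image_mset (($$) A) (mset_set ?grid) = replicate_mset 7 r + {#s, t#}"
      by (auto simp: matrices_of_def entries_mset_def)
    have count: "card {w \<in> ?grid. A $$ w = c} = count (replicate_mset 7 r + {#s, t#}) c" for c
    proof -
      have "{w. w \<in># mset_set ?grid \<and> c = A $$ w} = {w \<in> ?grid. A $$ w = c}"
        by auto
      then show ?thesis
        unfolding entries[symmetric] count_image_mset' by (simp add: count_mset_set')
    qed
    have "card {w \<in> ?grid. A $$ w = s} = 1"
      unfolding count using assms by auto
    then obtain u where u: "{w \<in> ?grid. A $$ w = s} = {u}"
      by (rule card_1_singletonE)
    have "card {w \<in> ?grid. A $$ w = t} = 1"
      unfolding count using assms by auto
    then obtain v where v: "{w \<in> ?grid. A $$ w = t} = {v}"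
      by (rule card_1_singletonE)
    have "A $$ w \<in># replicate_mset 7 r + {#s, t#}" if "w \<in> ?grid" for w
      unfolding entries[symmetric] using that by auto
    then have vals: "A $$ w \<in> {r, s, t}" if "w \<in> ?grid" for w
      using that by auto
    have u_iff: "A $$ w = s \<longleftrightarrow> w = u" and v_iff: "A $$ w = t \<longleftrightarrow> w = v" if "w \<in> ?grid" for w
      using that u v by blast+
    have "u \<in> ?grid" "v \<in> ?grid"
      using u v by blast+
    moreover have "u \<noteq> v"
      using \<open>s \<noteq> t\<close> u_iff v_iff \<open>u \<in> ?grid\<close> by metis
    ultimately have "(u, v) \<in> placements"
      unfolding placements_def by blast
    moreover have "A = placement_mat r s t (u, v)"
    proof (rule eq_matI)
      fix i j assume "i < dim_row (placement_mat r s t (u, v))" "j < dim_col (placement_mat r s t (u, v))"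
      then have ij: "(i, j) \<in> ?grid"
        by (simp add: placement_mat_def)
      have "A $$ (i, j) = (if (i, j) = u then s else if (i, j) = v then t else r)"
        using vals[OF ij] u_iff[OF ij] v_iff[OF ij] by (simp only: insert_iff empty_iff) argo
      then show "A $$ (i, j) = placement_mat r s t (u, v) $$ (i, j)"
        using ij by (simp add: placement_mat_def)
    qed (use A in \<open>simp_all add: placement_mat_def\<close>)
    ultimately show "A \<in> placement_mat r s t ` placements"
      by blast
  qed
qed


section \<open>Integral spectra and splitting over the rationals\<close>

lemma eigenvalue_smult:
  fixes A :: "'a::field mat"
  assumes A: "A \<in> carrier_mat n n" and "eigenvalue A k"
  shows "eigenvalue (c \<cdot>\<^sub>m A) (c * k)"
proof -
  from assms obtain v where v: "v \<in> carrier_vec (dim_row A)" "v \<noteq> 0\<^sub>v (dim_row A)"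
    and "A *\<^sub>v v = k \<cdot>\<^sub>v v"
    by (auto simp: eigenvalue_def eigenvector_def)
  moreover have "(c \<cdot>\<^sub>m A) *\<^sub>v v = c \<cdot>\<^sub>v (A *\<^sub>v v)"
    by (rule eq_vecI) (use A v in simp_all)
  ultimately show ?thesis
    by (auto simp: eigenvalue_def eigenvector_def smult_smult_assoc)
qed

text \<open>
  Dividing by \<open>r\<close> only rescales the eigenvalues, so it preserves their rationality. Integrality
  is recovered from rationality because the characteristic polynomial of \<open>A\<close> itself is monic with
  integer coefficients.
\<close>

lemma integral_spectrum_iff_splits_completely:
  assumes A: "A \<in> carrier_mat n n" and r: "r \<noteq> 0"
  shows "integral_spectrum A \<longleftrightarrow>
    splits_completely (char_poly ((1 / of_int r) \<cdot>\<^sub>m map_mat rat_of_int A))"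
proof -
  define N where "N = (1 / of_int r) \<cdot>\<^sub>m map_mat rat_of_int A"
  define C where "C = map_mat complex_of_int A"
  define D where "D = map_mat (of_rat :: rat \<Rightarrow> complex) N"
  have N: "N \<in> carrier_mat n n" and C: "C \<in> carrier_mat n n" and D: "D \<in> carrier_mat n n"
    using A by (simp_all add: N_def C_def D_def)
  have CD: "C = of_int r \<cdot>\<^sub>m D" and DC: "D = (1 / of_int r) \<cdot>\<^sub>m C"
    using r by (auto simp: C_def D_def N_def of_rat_mult of_rat_divide intro!: eq_matI)
  have char_D: "char_poly D = map_poly of_rat (char_poly N)"
    unfolding D_def by (rule of_rat_hom.char_poly_hom[OF N])
  interpret P: map_poly_inj_idom_hom "of_rat :: rat \<Rightarrow> complex" ..
  have monic: "coeff (char_poly N) n = 1"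
    using degree_monic_char_poly[OF N] by simp
  show ?thesis
    unfolding N_def[symmetric]
  proof
    assume int: "integral_spectrum A"
    obtain as where as: "char_poly D = (\<Prod>a\<leftarrow>as. [:- a, 1:])"
      using char_poly_factorized[OF D] by blast
    have "\<exists>b. a = of_rat b" if "a \<in> set as" for a
    proof -
      have "eigenvalue D a"
        unfolding eigenvalue_root_char_poly[OF D] as using linear_poly_root[OF that] .
      then have "of_int r * a \<in> spectrum C"
        unfolding CD by (simp add: spectrum_def eigenvalue_smult[OF D])
      then obtain k where "of_int r * a = of_int k"
        using int by (auto simp: integral_spectrum_def C_def elim: Ints_cases)
      then have "a = of_rat (of_int k / of_int r)"
        using r by (simp add: of_rat_divide field_simps)
      then show ?thesis ..
    qed
    then obtain f where f: "a = of_rat (f a)" if "a \<in> set as" for a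
      by metis
    have "map_poly of_rat (\<Prod>b\<leftarrow>map f as. [:- b, 1:]) = (\<Prod>a\<leftarrow>as. [:- complex_of_rat (f a), 1:])"
      by (simp add: P.hom_prod_list o_def of_rat_minus)
    also have "\<dots> = map_poly of_rat (char_poly N)"
      unfolding char_D[symmetric] as using f by (intro arg_cong[of _ _ prod_list] map_cong) auto
    \<comment> \<open>The factorisation descends to the rationals because the coefficient embedding is injective.\<close>
    finally have "char_poly N = (\<Prod>b\<leftarrow>map f as. [:- b, 1:])"
      by (simp only: P.eq_iff)
    then have "char_poly N = Polynomial.smult 1 (\<Prod>b\<leftarrow>map f as. [:- b, 1:])"
      by simp
    then show "splits_completely (char_poly N)"
      unfolding splits_completely_def by blast
  next
    assume "splits_completely (char_poly N)"
    then obtain c as where N_eq: "char_poly N = Polynomial.smult c (\<Prod>a\<leftarrow>as. [:- a, 1:])"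
      unfolding splits_completely_def by blast
    with monic have "c \<noteq> 0"
      by auto
    have "k \<in> \<int>" if "k \<in> spectrum C" for k
    proof -
      have "poly (char_poly D) (k / of_int r) = 0"
        using eigenvalue_smult[OF C, of k "1 / of_int r"] that eigenvalue_root_char_poly[OF D]
        by (simp add: spectrum_def DC)
      moreover have "poly (char_poly D) z = of_rat c * (\<Prod>a\<leftarrow>as. z - of_rat a)" for z
        unfolding char_D N_eq
        by (simp add: hom_distribs P.hom_prod_list o_def of_rat_minus poly_prod_list)
      ultimately have "(\<Prod>a\<leftarrow>as. k / of_int r - of_rat a) = 0"
        using \<open>c \<noteq> 0\<close> by simp
      then obtain a where "k / of_int r = of_rat a"
        by (auto simp: prod_list_zero_iff)
      then have "k = of_rat (of_int r * a)"
        using r by (simp add: of_rat_mult field_simps)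
      then have "k \<in> \<rat>"
        by simp
      moreover have "algebraic_int k"
        unfolding algebraic_int_altdef_ipoly
      proof (intro exI conjI)
        have "char_poly C = map_poly of_int (char_poly A)"
          unfolding C_def by (rule of_int_hom.char_poly_hom[OF A])
        then show "poly (map_poly of_int (char_poly A)) k = 0"
          using that eigenvalue_root_char_poly[OF C] by (simp add: spectrum_def)
        show "lead_coeff (char_poly A) = 1"
          using degree_monic_char_poly[OF A] by simp
      qed
      ultimately show ?thesis
        by (rule rational_algebraic_int_is_int[rotated])
    qed
    then show "integral_spectrum A"
      by (auto simp: integral_spectrum_def C_def)
  qed
qed

theorem proposition5p5:
  fixes r s t :: int and x y :: rat
  assumes "r \<noteq> s" and "r \<noteq> t" and "s \<noteq> t" and "r \<noteq> 0"
    and x: "x = of_int (s - r) / of_int r"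
    and y: "y = of_int (t - r) / of_int r"
  shows "x \<noteq> 0 \<and> y \<noteq> 0 \<and> x \<noteq> y \<and>
      (PSI 3 (replicate_mset 7 r + {#s, t#}) \<longleftrightarrow>
       splits_completely (p1x x y) \<and> splits_completely (p1y x y) \<and>
       splits_completely (p2 x y) \<and> splits_completely (p3 x y) \<and>
       splits_completely (p4x x y) \<and> splits_completely (p4y x y) \<and>
       splits_completely (p5 x y) \<and> splits_completely (p6 x y)) \<and>
      card placements = 72 \<and>
      card placement_orbits = 12 \<and>
      (\<lambda>p. char_poly (normalized_mat r s t p)) ` placements = (\<lambda>q. q x y) ` poly_types \<and>
      (\<lambda>p. \<lambda>x y. char_poly (deviation_mat x y p)) ` placements = poly_types \<and>
      card poly_types = 8"
proof -
  have nz: "x \<noteq> 0" "y \<noteq> 0" "x \<noteq> y"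
    using \<open>r \<noteq> s\<close> \<open>r \<noteq> t\<close> \<open>s \<noteq> t\<close> \<open>r \<noteq> 0\<close> by (simp_all add: x y)
  have norm: "char_poly (normalized_mat r s t p) = placement_type p x y" if "p \<in> placements" for p
    using that by (simp add: normalized_mat_eq_deviation_mat[OF \<open>r \<noteq> 0\<close>] char_poly_deviation_mat x y)
  have "(\<lambda>p. char_poly (normalized_mat r s t p)) ` placements
      = (\<lambda>q. q x y) ` placement_type ` placements"
    unfolding image_image by (rule image_cong) (simp_all add: norm)
  then have char_polys: "(\<lambda>p. char_poly (normalized_mat r s t p)) ` placements
      = (\<lambda>q. q x y) ` poly_types"
    by (simp add: placement_type_image)
  have "(\<lambda>p. \<lambda>x y. char_poly (deviation_mat x y p)) ` placements = placement_type ` placements"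
    by (rule image_cong) (simp_all add: char_poly_deviation_mat)
  then have types: "(\<lambda>p. \<lambda>x y. char_poly (deviation_mat x y p)) ` placements = poly_types"
    by (simp add: placement_type_image)
  have "integral_spectrum (placement_mat r s t p)
      \<longleftrightarrow> splits_completely (char_poly (normalized_mat r s t p))" for p
    unfolding normalized_mat_def
    by (rule integral_spectrum_iff_splits_completely[of _ 3])
      (simp_all add: placement_mat_def \<open>r \<noteq> 0\<close>)
  then have "PSI 3 (replicate_mset 7 r + {#s, t#})
      \<longleftrightarrow> (\<forall>q \<in> (\<lambda>p. char_poly (normalized_mat r s t p)) ` placements. splits_completely q)"
    unfolding PSI_def matrices_of_two_deviations[OF assms(1-3)] by simp
  also have "\<dots> \<longleftrightarrow> (\<forall>q \<in> poly_types. splits_completely (q x y))"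
    by (simp add: char_polys)
  finally have "PSI 3 (replicate_mset 7 r + {#s, t#})
      \<longleftrightarrow> (\<forall>q \<in> poly_types. splits_completely (q x y))" .
  then show ?thesis
    using nz char_polys types card_placements card_placement_orbits card_poly_types
    by (simp add: poly_types_def)
qed

end
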